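(* Let $X_j$, $j\geq 1$, be a collection of i.i.d. strictly positive real random variables defined on a probability space $(\Omega,\mathcal{F},P)$, having finite logarithmic variance $\sigma_\ell^2$ and logarithmic mean $m_\ell$. For $K\geq 2$ let $$\hat m_\ell(X)=\left(\prod_{j=1}^K X_j\right)^{1/K},\qquad \hat\sigma_\ell^2(X)=\frac{1}{K-1}\sum_{j=1}^K\left(\ln X_j-\ln\hat m_\ell(X)\right)^2.$$ Then $\hat\sigma_\ell^2(X)$ is an unbiased estimator of the logarithmic variance $\sigma_\ell^2$, and $$\hat\sigma_\ell^2(X)\rightarrow\sigma_\ell^2$$ almost surely with respect to $P$ as $K\to\infty$.
   Context: For a strictly positive random variable $X$ with square integrable logarithm, the logarithmic mean is $m_\ell(X)=\exp(E[\ln X])$ and the logarithmic variance is $\sigma_\ell^2(X)=E[(\ln X-\ln m_\ell(X))^2]=\mathrm{Var}(\ln X)$. *)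

theory Defs
  imports "HOL-Probability.Probability"
begin

definition log_mean :: "'a measure \<Rightarrow> ('a \<Rightarrow> real) \<Rightarrow> real" where
  "log_mean M X = exp (\<integral>\<omega>. ln (X \<omega>) \<partial>M)"

definition log_variance :: "'a measure \<Rightarrow> ('a \<Rightarrow> real) \<Rightarrow> real" where
  "log_variance M X = (\<integral>\<omega>. (ln (X \<omega>) - ln (log_mean M X))\<^sup>2 \<partial>M)"

text \<open>
  Because the Bochner integral and \<^const>\<open>ln\<close> are total, the two definitions above are only
  meaningful under the following condition. A square integrable logarithm is also integrable
  on a probability space.
\<close>
definition finite_log_variance :: "'a measure \<Rightarrow> ('a \<Rightarrow> real) \<Rightarrow> bool" where
  "finite_log_variance M X \<longleftrightarrow>
     X \<in> borel_measurable M \<and> (\<forall>\<omega>\<in>space M. X \<omega> > 0) \<and> integrable M (\<lambda>\<omega>. (ln (X \<omega>))\<^sup>2)"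

definition iid_from_one :: "'a measure \<Rightarrow> (nat \<Rightarrow> 'a \<Rightarrow> real) \<Rightarrow> bool" where
  "iid_from_one M X \<longleftrightarrow>
     prob_space.indep_vars M (\<lambda>_. borel) X {1..} \<and>
     (\<forall>j\<ge>1. distr M borel (X j) = distr M borel (X 1))"

text \<open>The sample consists of the variables with indices 1 to K; the index 0 is never used.\<close>
definition log_mean_est :: "(nat \<Rightarrow> 'a \<Rightarrow> real) \<Rightarrow> nat \<Rightarrow> 'a \<Rightarrow> real" where
  "log_mean_est X K \<omega> = (\<Prod>j=1..K. X j \<omega>) powr (1 / real K)"

definition log_variance_est :: "(nat \<Rightarrow> 'a \<Rightarrow> real) \<Rightarrow> nat \<Rightarrow> 'a \<Rightarrow> real" where
  "log_variance_est X K \<omega> =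
     1 / (real K - 1) * (\<Sum>j=1..K. (ln (X j \<omega>) - ln (log_mean_est X K \<omega>))\<^sup>2)"

text \<open>Integrability is part of the definition, since non-integrable functions have integral 0.\<close>
definition unbiased_estimator :: "'a measure \<Rightarrow> ('a \<Rightarrow> real) \<Rightarrow> real \<Rightarrow> bool" where
  "unbiased_estimator M T \<theta> \<longleftrightarrow> integrable M T \<and> (\<integral>\<omega>. T \<omega> \<partial>M) = \<theta>"

end

theory Submission
  imports Defs "HOL-Real_Asymp.Real_Asymp"
begin

text \<open>
  Write \<open>Y\<^sub>j = ln X\<^sub>j\<close>. The logarithm of the geometric mean is the arithmetic mean of the
  \<open>Y\<^sub>j\<close>, so the estimator is the ordinary sample variance of \<open>Y\<^sub>1, \<dots>, Y\<^sub>K\<close>. Expanding the squares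
  around any centre \<open>c\<close> gives
  \<open>(K - 1) s\<^sup>2 = \<Sum> (Y\<^sub>j - c)\<^sup>2 - (\<Sum> (Y\<^sub>j - c))\<^sup>2 / K\<close>
  (lemma \<open>sum_squared_deviations\<close>). With \<open>c\<close> the common expectation, the mixed terms
  of the second sum have expectation zero by independence, and what is left is \<open>(K - 1) \<sigma>\<^sup>2\<close>.
  For almost sure convergence, the same identity writes \<open>s\<^sup>2\<close> as \<open>K / (K - 1)\<close> times the mean of
  the \<open>(Y\<^sub>j - c)\<^sup>2\<close> minus the squared mean of the \<open>Y\<^sub>j - c\<close>. The strong law of large numbers applies
  to both sequences.

  The strong law is needed for variables that are merely integrable, because the squares of the
  \<open>Y\<^sub>j\<close> need not have a second moment. It follows from a statement about random walks
  (lemma \<open>random_walk_negative_drift_bounded\<close>): if the steps have negative expectation, the walk is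
  almost surely bounded above. Applied to the steps \<open>Y\<^sub>j - E Y - \<epsilon>\<close> and \<open>E Y - Y\<^sub>j - \<epsilon>\<close>, this bounds
  \<open>|S\<^sub>n - n E Y|\<close> by \<open>n \<epsilon>\<close> plus a random constant.

  Being unbounded above is a tail event, so by Kolmogorov it has probability 0 or 1. If the
  probability were 1, let \<open>M\<^sub>n\<close> be the maximum of the first \<open>n\<close> partial sums (and 0) and \<open>M'\<^sub>n\<close> the
  same maximum for the walk without its first step. Then \<open>M\<^sub>n\<^sub>+\<^sub>1 = max 0 (Y\<^sub>0 + M'\<^sub>n)\<close>, hence
  \<open>M\<^sub>n\<^sub>+\<^sub>1 - M'\<^sub>n = max (- M'\<^sub>n) Y\<^sub>0\<close>. The left side has expectation at least 0, since \<open>M\<^sub>n\<close> increases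
  with \<open>n\<close> and \<open>M'\<^sub>n\<close> is distributed like \<open>M\<^sub>n\<close>. The right side tends to \<open>Y\<^sub>0\<close> since
  \<open>M'\<^sub>n\<close> tends to infinity, and is dominated by \<open>|Y\<^sub>0|\<close>. So \<open>E Y\<^sub>0 \<ge> 0\<close>, a contradiction.
\<close>

section \<open>The running maximum of a walk\<close>

text \<open>
  The maximum of the partial sums of at most \<open>n\<close> steps, the empty sum included. The recursion removes
  the first step of the walk rather than the last, since the comparison with the walk started one
  step later is the core of the argument.
\<close>
primrec running_max :: "nat \<Rightarrow> (nat \<Rightarrow> real) \<Rightarrow> real" where
  "running_max 0 x = 0"
| "running_max (Suc n) x = max 0 (x 0 + running_max n (\<lambda>i. x (Suc i)))"

lemma running_max_nonneg: "0 \<le> running_max n x"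
  by (cases n) auto

lemma running_max_le_Suc: "running_max n x \<le> running_max (Suc n) x"
proof (induction n arbitrary: x)
  case (Suc n)
  show ?case
    using Suc[of "\<lambda>i. x (Suc i)"] by simp
qed simp

lemma running_max_mono: "m \<le> n \<Longrightarrow> running_max m x \<le> running_max n x"
  by (rule lift_Suc_mono_le[of "\<lambda>n. running_max n x"]) (rule running_max_le_Suc)

lemma sum_le_running_max: "(\<Sum>i<n. x i) \<le> running_max n x"
proof (induction n arbitrary: x)
  case (Suc n)
  have "(\<Sum>i<Suc n. x i) = x 0 + (\<Sum>i<n. x (Suc i))"
    by (rule sum.lessThan_Suc_shift)
  with Suc[of "\<lambda>i. x (Suc i)"] show ?case
    by simp
qed simp

lemma running_max_le_sum_abs: "running_max n x \<le> (\<Sum>i<n. \<bar>x i\<bar>)"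
proof (induction n arbitrary: x)
  case (Suc n)
  have "(\<Sum>i<Suc n. \<bar>x i\<bar>) = \<bar>x 0\<bar> + (\<Sum>i<n. \<bar>x (Suc i)\<bar>)"
    by (rule sum.lessThan_Suc_shift)
  moreover have "0 \<le> (\<Sum>i<n. \<bar>x (Suc i)\<bar>)"
    by (rule sum_nonneg) simp
  ultimately show ?case
    using Suc[of "\<lambda>i. x (Suc i)"] by simp
qed simp

lemma running_max_at_top:
  assumes "\<forall>b::nat. \<exists>m. real b < (\<Sum>i<m. x i)"
  shows "filterlim (\<lambda>n. running_max n x) at_top sequentially"
  unfolding filterlim_at_top
proof
  fix Z :: real
  obtain b :: nat where "Z \<le> real b"
    using real_arch_simple by blast
  moreover obtain m where "real b < (\<Sum>i<m. x i)"
    using assms by blast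
  ultimately have "Z \<le> running_max m x"
    using sum_le_running_max[of x m] by linarith
  then have "\<forall>n\<ge>m. Z \<le> running_max n x"
    using running_max_mono order_trans by blast
  then show "\<forall>\<^sub>F n in sequentially. Z \<le> running_max n x"
    unfolding eventually_sequentially by blast
qed

lemma borel_measurable_running_max:
  assumes "\<And>i. (\<lambda>\<omega>. Y i \<omega>) \<in> borel_measurable N"
  shows "(\<lambda>\<omega>. running_max n (\<lambda>i. Y i \<omega>)) \<in> borel_measurable N"
  using assms
proof (induction n arbitrary: Y)
  case (Suc n)
  have [measurable]: "(\<lambda>\<omega>. running_max n (\<lambda>i. Y (Suc i) \<omega>)) \<in> borel_measurable N"
    using Suc.prems by (intro Suc.IH)
  have [measurable]: "Y 0 \<in> borel_measurable N"
    using Suc.prems .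
  show ?case
    by simp
qed simp

text \<open>
  Removing finitely many steps shifts all later partial sums by a constant; this makes
  unboundedness a tail event.
\<close>
lemma unbounded_sums_shift:
  fixes x :: "nat \<Rightarrow> real"
  shows "(\<forall>b::nat. \<exists>m. real b < (\<Sum>i<m. x i)) \<longleftrightarrow> (\<forall>b::nat. \<exists>m. real b < (\<Sum>i<m. x (k + i)))"
proof (induction k)
  case (Suc k)
  have shift: "(\<Sum>i<Suc m. y i) = y 0 + (\<Sum>i<m. y (Suc i))" for y :: "nat \<Rightarrow> real" and m
    by (rule sum.lessThan_Suc_shift)
  have "(\<forall>b::nat. \<exists>m. real b < (\<Sum>i<m. y i)) \<longleftrightarrow> (\<forall>b::nat. \<exists>m. real b < (\<Sum>i<m. y (Suc i)))"
    (is "?L \<longleftrightarrow> ?R") for y :: "nat \<Rightarrow> real"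
  proof
    assume L: ?L
    show ?R
    proof
      fix b :: nat
      obtain c :: nat where c: "real b + \<bar>y 0\<bar> \<le> real c"
        using real_arch_simple by blast
      obtain m where m: "real c < (\<Sum>i<m. y i)"
        using L by blast
      then obtain m' where "m = Suc m'"
        by (cases m) auto
      with m c shift[of y m'] have "real b < (\<Sum>i<m'. y (Suc i))"
        by simp
      then show "\<exists>m. real b < (\<Sum>i<m. y (Suc i))" ..
    qed
  next
    assume R: ?R
    show ?L
    proof
      fix b :: nat
      obtain c :: nat where c: "real b + \<bar>y 0\<bar> \<le> real c"
        using real_arch_simple by blast
      obtain m where "real c < (\<Sum>i<m. y (Suc i))"
        using R by blast
      with c shift[of y m] have "real b < (\<Sum>i<Suc m. y i)"
        by simp
      then show "\<exists>m. real b < (\<Sum>i<m. y i)" ..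
    qed
  qed
  from this[of "\<lambda>i. x (k + i)"] Suc show ?case
    by simp
qed simp

section \<open>The strong law of large numbers\<close>

lemma (in prob_space) indep_vars_reindex:
  assumes indep: "indep_vars N X (f ` I)" and inj: "inj_on f I"
  shows "indep_vars (\<lambda>i. N (f i)) (\<lambda>i. X (f i)) I"
  unfolding indep_vars_def2
proof (intro conjI ballI)
  show "random_variable (N (f i)) (X (f i))" if "i \<in> I" for i
    using indep that by (auto simp: indep_vars_def2)
  have sets: "indep_sets (\<lambda>j. {X j -` A \<inter> space M |A. A \<in> sets (N j)}) (f ` I)"
    using indep by (auto simp: indep_vars_def2)
  show "indep_sets (\<lambda>i. {X (f i) -` A \<inter> space M |A. A \<in> sets (N (f i))}) I"
  proof (rule indep_setsI)
    show "{X (f i) -` A \<inter> space M |A. A \<in> sets (N (f i))} \<subseteq> events" if "i \<in> I" for i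
      using sets that unfolding indep_sets_def by auto
    fix A J
    assume J: "J \<noteq> {}" "J \<subseteq> I" "finite J"
      and A: "\<forall>j\<in>J. A j \<in> {X (f j) -` A \<inter> space M |A. A \<in> sets (N (f j))}"
    let ?g = "the_inv_into J f"
    have injJ: "inj_on f J"
      using inj J(2) by (rule inj_on_subset)
    have g: "?g (f j) = j" if "j \<in> J" for j
      using injJ that by (rule the_inv_into_f_f)
    have "prob (\<Inter>j\<in>f ` J. A (?g j)) = (\<Prod>j\<in>f ` J. prob (A (?g j)))"
      using J A g by (intro indep_setsD[OF sets]) auto
    then show "prob (\<Inter>j\<in>J. A j) = (\<Prod>j\<in>J. prob (A j))"
      using g by (simp add: prod.reindex[OF injJ])
  qed
qed

text \<open>
  The joint law of an independent sequence is the product of the marginal laws, so a sequence that is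
  also identically distributed is stationary.
\<close>
lemma (in prob_space) iid_shift_distr:
  fixes Y :: "nat \<Rightarrow> 'a \<Rightarrow> real"
  assumes indep: "indep_vars (\<lambda>_. borel) Y UNIV"
    and ident: "\<And>i. distr M borel (Y i) = distr M borel (Y 0)"
  shows "distr M (\<Pi>\<^sub>M i\<in>UNIV. borel) (\<lambda>\<omega> i. Y (Suc i) \<omega>) = distr M (\<Pi>\<^sub>M i\<in>UNIV. borel) (\<lambda>\<omega> i. Y i \<omega>)"
proof -
  have rv: "random_variable borel (Y i)" for i
    using indep by (auto simp: indep_vars_def2)
  have "indep_vars (\<lambda>_. borel) Y (range Suc)"
    using indep by (rule indep_vars_subset) simp
  then have indep': "indep_vars (\<lambda>_. borel) (\<lambda>i. Y (Suc i)) UNIV"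
    by (rule indep_vars_reindex) simp
  have "distr M (\<Pi>\<^sub>M i\<in>UNIV. borel) (\<lambda>\<omega> i. Y (Suc i) \<omega>) = (\<Pi>\<^sub>M i\<in>UNIV. distr M borel (Y (Suc i)))"
    using indep' indep_vars_iff_distr_eq_PiM[of UNIV "\<lambda>i. Y (Suc i)" "\<lambda>_. borel"] rv
    by (simp add: restrict_UNIV)
  also have "\<dots> = (\<Pi>\<^sub>M i\<in>UNIV. distr M borel (Y i))"
  proof (rule PiM_cong)
    show "distr M borel (Y (Suc i)) = distr M borel (Y i)" for i
      using ident[of i] ident[of "Suc i"] by simp
  qed simp
  also have "\<dots> = distr M (\<Pi>\<^sub>M i\<in>UNIV. borel) (\<lambda>\<omega> i. Y i \<omega>)"
    using indep indep_vars_iff_distr_eq_PiM[of UNIV Y "\<lambda>_. borel"] rv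
    by (simp add: restrict_UNIV)
  finally show ?thesis .
qed

lemma (in prob_space) expectation_running_max_shift:
  fixes Y :: "nat \<Rightarrow> 'a \<Rightarrow> real"
  assumes indep: "indep_vars (\<lambda>_. borel) Y UNIV"
    and ident: "\<And>i. distr M borel (Y i) = distr M borel (Y 0)"
  shows "expectation (\<lambda>\<omega>. running_max n (\<lambda>i. Y (Suc i) \<omega>)) = expectation (\<lambda>\<omega>. running_max n (\<lambda>i. Y i \<omega>))"
proof -
  have rv [measurable]: "random_variable borel (Y i)" for i
    using indep by (auto simp: indep_vars_def2)
  have meas: "running_max n \<in> borel_measurable (\<Pi>\<^sub>M i\<in>UNIV. borel)"
    using borel_measurable_running_max[of "\<lambda>i x. x i" "\<Pi>\<^sub>M i\<in>UNIV. borel" n] by simp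
  have "(\<lambda>\<omega> i. Z i \<omega>) \<in> measurable M (\<Pi>\<^sub>M i\<in>UNIV. borel)"
    if "\<And>i. random_variable borel (Z i)" for Z :: "nat \<Rightarrow> 'a \<Rightarrow> real"
    using that by (intro measurable_PiM_single') auto
  then have "expectation (\<lambda>\<omega>. running_max n (\<lambda>i. Z i \<omega>)) =
      integral\<^sup>L (distr M (\<Pi>\<^sub>M i\<in>UNIV. borel) (\<lambda>\<omega> i. Z i \<omega>)) (running_max n)"
    if "\<And>i. random_variable borel (Z i)" for Z :: "nat \<Rightarrow> 'a \<Rightarrow> real"
    using that by (intro integral_distr[OF _ meas, symmetric]) blast
  from this[of Y] this[of "\<lambda>i. Y (Suc i)"] show ?thesis
    using iid_shift_distr[OF indep ident] by simp
qed

text \<open>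
  Stationarity makes the expected increment from \<open>?M' n\<close> to \<open>?M (Suc n)\<close> nonnegative, although for
  large \<open>n\<close> this increment is eventually equal to the first step \<open>Y 0\<close>. Combined with the zero-one
  law, this bounds every walk with negative drift.
\<close>
lemma (in prob_space) random_walk_unbounded_imp_drift_nonneg:
  fixes Y :: "nat \<Rightarrow> 'a \<Rightarrow> real"
  assumes indep: "indep_vars (\<lambda>_. borel) Y UNIV"
    and ident: "\<And>i. distr M borel (Y i) = distr M borel (Y 0)"
    and int: "\<And>i. integrable M (Y i)"
    and unbounded: "AE \<omega> in M. \<forall>b::nat. \<exists>m. real b < (\<Sum>i<m. Y i \<omega>)"
  shows "0 \<le> expectation (Y 0)"
proof -
  have rv [measurable]: "random_variable borel (Y i)" for i
    using int by auto
  let ?M = "\<lambda>n \<omega>. running_max n (\<lambda>i. Y i \<omega>)"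
  let ?M' = "\<lambda>n \<omega>. running_max n (\<lambda>i. Y (Suc i) \<omega>)"
  have int_max: "integrable M (\<lambda>\<omega>. running_max n (\<lambda>i. Z i \<omega>))"
    if "\<And>i. integrable M (Z i)" for n and Z :: "nat \<Rightarrow> 'a \<Rightarrow> real"
  proof (rule Bochner_Integration.integrable_bound)
    show "integrable M (\<lambda>\<omega>. \<Sum>i<n. \<bar>Z i \<omega>\<bar>)"
      using that by simp
    show "random_variable borel (\<lambda>\<omega>. running_max n (\<lambda>i. Z i \<omega>))"
      using that by (intro borel_measurable_running_max) auto
    show "AE \<omega> in M. norm (running_max n (\<lambda>i. Z i \<omega>)) \<le> norm (\<Sum>i<n. \<bar>Z i \<omega>\<bar>)"
    proof (rule AE_I2)
      fix \<omega>
      show "norm (running_max n (\<lambda>i. Z i \<omega>)) \<le> norm (\<Sum>i<n. \<bar>Z i \<omega>\<bar>)"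
        using running_max_nonneg[of n "\<lambda>i. Z i \<omega>"] running_max_le_sum_abs[of n "\<lambda>i. Z i \<omega>"] by simp
    qed
  qed
  have diff: "max (- ?M' n \<omega>) (Y 0 \<omega>) = ?M (Suc n) \<omega> - ?M' n \<omega>" for n \<omega>
    by (simp add: max_def)
  have nonneg: "0 \<le> expectation (\<lambda>\<omega>. max (- ?M' n \<omega>) (Y 0 \<omega>))" for n
  proof -
    have "expectation (?M' n) = expectation (?M n)"
      using indep ident by (rule expectation_running_max_shift)
    also have "\<dots> \<le> expectation (?M (Suc n))"
      using int by (intro integral_mono int_max running_max_le_Suc)
    finally have "0 \<le> expectation (?M (Suc n)) - expectation (?M' n)"
      by simp
    also have "\<dots> = expectation (\<lambda>\<omega>. ?M (Suc n) \<omega> - ?M' n \<omega>)"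
      using int by (intro Bochner_Integration.integral_diff[symmetric] int_max)
    finally show ?thesis
      unfolding diff .
  qed
  have meas: "random_variable borel (?M' n)" for n
    using rv by (intro borel_measurable_running_max)
  have "(\<lambda>n. expectation (\<lambda>\<omega>. max (- ?M' n \<omega>) (Y 0 \<omega>))) \<longlonglongrightarrow> expectation (Y 0)"
  proof (rule integral_dominated_convergence)
    show "integrable M (\<lambda>\<omega>. \<bar>Y 0 \<omega>\<bar>)"
      using int by simp
    show "AE \<omega> in M. (\<lambda>n. max (- ?M' n \<omega>) (Y 0 \<omega>)) \<longlonglongrightarrow> Y 0 \<omega>"
      using unbounded
    proof eventually_elim
      case (elim \<omega>)
      then have "\<forall>b::nat. \<exists>m. real b < (\<Sum>i<m. Y (Suc i) \<omega>)"
        using unbounded_sums_shift[of "\<lambda>i. Y i \<omega>" 1] by simp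
      then have "filterlim (\<lambda>n. ?M' n \<omega>) at_top sequentially"
        by (rule running_max_at_top)
      then have "\<forall>\<^sub>F n in sequentially. - Y 0 \<omega> \<le> ?M' n \<omega>"
        unfolding filterlim_at_top by blast
      then have "\<forall>\<^sub>F n in sequentially. max (- ?M' n \<omega>) (Y 0 \<omega>) = Y 0 \<omega>"
        by eventually_elim simp
      then show ?case
        by (rule tendsto_eventually)
    qed
    show "AE \<omega> in M. norm (max (- ?M' n \<omega>) (Y 0 \<omega>)) \<le> \<bar>Y 0 \<omega>\<bar>" for n
    proof (rule AE_I2)
      fix \<omega>
      show "norm (max (- ?M' n \<omega>) (Y 0 \<omega>)) \<le> \<bar>Y 0 \<omega>\<bar>"
        using running_max_nonneg[of n "\<lambda>i. Y (Suc i) \<omega>"] by (simp add: max_def abs_if)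
    qed
  qed (use meas in measurable)
  then show ?thesis
    by (rule LIMSEQ_le_const) (use nonneg in blast)
qed

text \<open>
  For every \<open>n\<close>, the event can be described by the walk started at step \<open>n\<close>, which is measurable
  for the \<open>\<sigma>\<close>-algebra generated by the steps from \<open>n\<close> on.
\<close>
lemma (in prob_space) random_walk_unbounded_0_1:
  fixes Y :: "nat \<Rightarrow> 'a \<Rightarrow> real"
  assumes indep: "indep_vars (\<lambda>_. borel) Y UNIV"
  defines "U \<equiv> {\<omega>\<in>space M. \<forall>b::nat. \<exists>m. real b < (\<Sum>i<m. Y i \<omega>)}"
  shows "prob U = 0 \<or> prob U = 1"
proof -
  let ?G = "\<lambda>i. {Y i -` A \<inter> space M |A. A \<in> sets borel}"
  let ?A = "\<lambda>i. sigma_sets (space M) (?G i)"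
  show ?thesis
  proof (rule kolmogorov_0_1_law[of ?A])
    show "sigma_algebra (space M) (?A i)" for i
      by (rule sigma_algebra_sigma_sets) auto
    show "indep_sets ?A UNIV"
      using indep unfolding indep_vars_def by simp
    show "U \<in> tail_events ?A"
      unfolding tail_events_def
    proof
      fix n
      let ?N = "sigma (space M) (\<Union>i\<in>{n..}. ?A i)"
      have sub: "?A i \<subseteq> Pow (space M)" for i
        using sigma_sets_into_sp[of "?G i" "space M"] by auto
      then have sets_N: "sets ?N = sigma_sets (space M) (\<Union>i\<in>{n..}. ?A i)"
        by (intro sets_measure_of) auto
      have space_N: "space ?N = space M"
        using sub by (intro space_measure_of) auto
      have [measurable]: "Y (n + i) \<in> borel_measurable ?N" for i
      proof (rule measurableI)
        fix B :: "real set"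
        assume "B \<in> sets borel"
        then have "Y (n + i) -` B \<inter> space M \<in> ?A (n + i)"
          by (intro sigma_sets.Basic) auto
        then have "Y (n + i) -` B \<inter> space M \<in> (\<Union>i\<in>{n..}. ?A i)"
          by (intro UN_I[of "n + i"]) simp
        then have "Y (n + i) -` B \<inter> space M \<in> sets ?N"
          unfolding sets_N by (rule sigma_sets.Basic)
        then show "Y (n + i) -` B \<inter> space ?N \<in> sets ?N"
          unfolding space_N .
      qed simp
      have "U = {\<omega>\<in>space ?N. \<forall>b::nat. \<exists>m. real b < (\<Sum>i<m. Y (n + i) \<omega>)}"
        unfolding U_def space_N by (intro Collect_cong conj_cong refl unbounded_sums_shift)
      also have "\<dots> \<in> sets ?N"
        by measurable
      finally show "U \<in> sigma_sets (space M) (\<Union>i\<in>{n..}. ?A i)"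
        unfolding sets_N .
    qed
  qed
qed

lemma (in prob_space) random_walk_negative_drift_bounded:
  fixes Y :: "nat \<Rightarrow> 'a \<Rightarrow> real"
  assumes indep: "indep_vars (\<lambda>_. borel) Y UNIV"
    and ident: "\<And>i. distr M borel (Y i) = distr M borel (Y 0)"
    and int: "\<And>i. integrable M (Y i)"
    and drift: "expectation (Y 0) < 0"
  shows "AE \<omega> in M. \<exists>b::nat. \<forall>m. (\<Sum>i<m. Y i \<omega>) \<le> real b"
proof -
  let ?P = "\<lambda>\<omega>. \<forall>b::nat. \<exists>m. real b < (\<Sum>i<m. Y i \<omega>)"
  have [measurable]: "random_variable borel (Y i)" for i
    using int by auto
  have "prob {\<omega>\<in>space M. ?P \<omega>} \<noteq> 1"
  proof
    assume "prob {\<omega>\<in>space M. ?P \<omega>} = 1"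
    then have "AE \<omega> in M. ?P \<omega>"
      by (subst (asm) prob_Collect_eq_1) measurable
    then have "0 \<le> expectation (Y 0)"
      by (rule random_walk_unbounded_imp_drift_nonneg[OF indep ident int])
    with drift show False
      by simp
  qed
  then have "prob {\<omega>\<in>space M. ?P \<omega>} = 0"
    using random_walk_unbounded_0_1[OF indep] by blast
  then have "AE \<omega> in M. \<not> ?P \<omega>"
    by (subst (asm) prob_Collect_eq_0) measurable
  then show ?thesis
    by (simp add: not_less)
qed

text \<open>
  The deterministic half of the strong law. It lets the tolerance run through the countable set of all
  \<open>1 / Suc k\<close>, so that only countably many null sets are discarded.
\<close>
lemma average_tendsto:
  fixes x :: "nat \<Rightarrow> real"
  assumes "\<And>k. \<exists>b. \<forall>n. (\<Sum>i<n. x i - c - 1 / real (Suc k)) \<le> b"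
    and "\<And>k. \<exists>b. \<forall>n. (\<Sum>i<n. c - x i - 1 / real (Suc k)) \<le> b"
  shows "(\<lambda>n. (\<Sum>i<n. x i) / real n) \<longlonglongrightarrow> c"
proof (rule LIMSEQ_I)
  fix r :: real
  assume "0 < r"
  then obtain k where k: "1 / real (Suc k) < r / 2"
    using nat_approx_posE[of "r / 2"] by auto
  define e where "e = 1 / real (Suc k)"
  obtain b1 where b1: "\<And>n. (\<Sum>i<n. x i - c - e) \<le> b1"
    using assms(1)[of k] unfolding e_def by blast
  obtain b2 where b2: "\<And>n. (\<Sum>i<n. c - x i - e) \<le> b2"
    using assms(2)[of k] unfolding e_def by blast
  define b where "b = max b1 b2"
  \<comment> \<open>Beyond \<open>N\<close>, the constant \<open>b\<close> contributes less than \<open>r / 2\<close> to the average; \<open>e\<close> is the other half.\<close>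
  obtain N :: nat where N: "2 * b / r < real N"
    using reals_Archimedean2 by blast
  have "norm ((\<Sum>i<n. x i) / real n - c) < r" if n: "n \<ge> Suc N" for n
  proof -
    have "2 * b / r < real n"
      using N n by simp
    then have b: "b < real n * (r / 2)"
      using \<open>0 < r\<close> by (simp add: field_simps)
    have "(\<Sum>i<n. x i) - real n * c \<le> b + real n * e"
      using b1[of n] by (simp add: b_def sum_subtractf)
    moreover have "real n * c - (\<Sum>i<n. x i) \<le> b + real n * e"
      using b2[of n] by (simp add: b_def sum_subtractf)
    moreover have "real n * e < real n * (r / 2)"
      using k n unfolding e_def by (intro mult_strict_left_mono) auto
    ultimately have "\<bar>(\<Sum>i<n. x i) - real n * c\<bar> < real n * r"
      using b by (simp add: abs_less_iff algebra_simps)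
    moreover have "(\<Sum>i<n. x i) / real n - c = ((\<Sum>i<n. x i) - real n * c) / real n"
      using n by (simp add: field_simps)
    ultimately show ?thesis
      using n by (simp add: field_simps)
  qed
  then show "\<exists>N. \<forall>n\<ge>N. norm ((\<Sum>i<n. x i) / real n - c) < r"
    by blast
qed

theorem (in prob_space) strong_law_of_large_numbers:
  fixes Y :: "nat \<Rightarrow> 'a \<Rightarrow> real"
  assumes indep: "indep_vars (\<lambda>_. borel) Y UNIV"
    and ident: "\<And>i. distr M borel (Y i) = distr M borel (Y 0)"
    and int: "integrable M (Y 0)"
  shows "AE \<omega> in M. (\<lambda>n. (\<Sum>i<n. Y i \<omega>) / real n) \<longlonglongrightarrow> expectation (Y 0)"
proof -
  let ?c = "expectation (Y 0)"
  have rv: "random_variable borel (Y i)" for i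
    using indep by (auto simp: indep_vars_def2)
  have ints: "integrable M (Y i)" for i
    using int integrable_distr_eq[OF rv[of i], of "\<lambda>x. x"]
      integrable_distr_eq[OF rv[of 0], of "\<lambda>x. x"] ident[of i] by simp
  have bounded: "AE \<omega> in M. \<exists>b::nat. \<forall>m. (\<Sum>i<m. f (Y i \<omega>)) \<le> real b"
    if f [measurable]: "f \<in> borel_measurable borel" and "\<And>i. integrable M (\<lambda>\<omega>. f (Y i \<omega>))"
      and "expectation (\<lambda>\<omega>. f (Y 0 \<omega>)) < 0" for f :: "real \<Rightarrow> real"
  proof (rule random_walk_negative_drift_bounded)
    show "indep_vars (\<lambda>_. borel) (\<lambda>i \<omega>. f (Y i \<omega>)) UNIV"
      using indep f by (rule indep_vars_compose2)
    show "distr M borel (\<lambda>\<omega>. f (Y i \<omega>)) = distr M borel (\<lambda>\<omega>. f (Y 0 \<omega>))" for i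
      using distr_distr[OF f rv[of i]] distr_distr[OF f rv[of 0]] ident[of i]
      by (simp add: comp_def)
  qed fact+
  have upper: "AE \<omega> in M. \<forall>k. \<exists>b::nat. \<forall>m. (\<Sum>i<m. Y i \<omega> - ?c - 1 / real (Suc k)) \<le> real b"
    unfolding AE_all_countable
  proof
    fix k
    show "AE \<omega> in M. \<exists>b::nat. \<forall>m. (\<Sum>i<m. Y i \<omega> - ?c - 1 / real (Suc k)) \<le> real b"
      using ints by (intro bounded[of "\<lambda>y. y - ?c - 1 / real (Suc k)"]) (auto simp: prob_space)
  qed
  have lower: "AE \<omega> in M. \<forall>k. \<exists>b::nat. \<forall>m. (\<Sum>i<m. ?c - Y i \<omega> - 1 / real (Suc k)) \<le> real b"
    unfolding AE_all_countable
  proof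
    fix k
    show "AE \<omega> in M. \<exists>b::nat. \<forall>m. (\<Sum>i<m. ?c - Y i \<omega> - 1 / real (Suc k)) \<le> real b"
      using ints by (intro bounded[of "\<lambda>y. ?c - y - 1 / real (Suc k)"]) (auto simp: prob_space)
  qed
  from upper lower show ?thesis
  proof eventually_elim
    case (elim \<omega>)
    then show ?case
      by (intro average_tendsto) blast+
  qed
qed

section \<open>The sample variance\<close>

definition sample_variance :: "(nat \<Rightarrow> real) \<Rightarrow> nat \<Rightarrow> real" where
  "sample_variance y K = 1 / (real K - 1) * (\<Sum>j<K. (y j - (\<Sum>i<K. y i) / real K)\<^sup>2)"

lemma sum_squared_deviations:
  fixes y :: "nat \<Rightarrow> real"
  assumes "K \<noteq> 0"
  shows "(\<Sum>j<K. (y j - (\<Sum>i<K. y i) / real K)\<^sup>2) =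
    (\<Sum>j<K. (y j - c)\<^sup>2) - (\<Sum>j<K. y j - c)\<^sup>2 / real K"
proof -
  define z where "z = (\<lambda>j. y j - c)"
  define s where "s = (\<Sum>j<K. z j)"
  have "y j - (\<Sum>i<K. y i) / real K = z j - s / real K" for j
    using assms by (simp add: z_def s_def sum_subtractf diff_divide_distrib)
  then have "(\<Sum>j<K. (y j - (\<Sum>i<K. y i) / real K)\<^sup>2) = (\<Sum>j<K. (z j - s / real K)\<^sup>2)"
    by simp
  also have "\<dots> = (\<Sum>j<K. (z j)\<^sup>2 - 2 * (s / real K) * z j + (s / real K)\<^sup>2)"
    by (intro sum.cong) (auto simp: power2_eq_square algebra_simps)
  also have "\<dots> = (\<Sum>j<K. (z j)\<^sup>2) - 2 * (s / real K) * s + real K * (s / real K)\<^sup>2"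
    by (simp add: sum.distrib sum_subtractf s_def sum_distrib_left)
  also have "\<dots> = (\<Sum>j<K. (z j)\<^sup>2) - s\<^sup>2 / real K"
    using assms by (simp add: power2_eq_square field_simps)
  finally show ?thesis
    by (simp add: z_def s_def)
qed

text \<open>The logarithm turns the geometric mean into the arithmetic mean.\<close>
lemma log_variance_est_eq_sample_variance:
  assumes "\<And>j. j \<ge> 1 \<Longrightarrow> X j \<omega> > 0"
  shows "log_variance_est X K \<omega> = sample_variance (\<lambda>i. ln (X (Suc i) \<omega>)) K"
proof -
  have shift: "(\<Sum>j=1..K. g j) = (\<Sum>j<K. g (Suc j))" for g :: "nat \<Rightarrow> real"
    by (simp add: sum.atLeast1_atMost_eq)
  have pos: "(\<Prod>j=1..K. X j \<omega>) > 0"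
    using assms by (intro prod_pos) auto
  have "ln (log_mean_est X K \<omega>) = ln (\<Prod>j=1..K. X j \<omega>) / real K"
    using pos by (simp add: log_mean_est_def)
  also have "ln (\<Prod>j=1..K. X j \<omega>) = (\<Sum>j=1..K. ln (X j \<omega>))"
    using assms by (intro ln_prod) (auto simp: less_imp_neq[symmetric])
  finally show ?thesis
    unfolding log_variance_est_def sample_variance_def shift by simp
qed

text \<open>By independence, the mixed terms in the square of a centred sum have expectation zero.\<close>
lemma (in prob_space) centred_indep_sum_square:
  fixes Z :: "nat \<Rightarrow> 'a \<Rightarrow> real"
  assumes indep: "indep_vars (\<lambda>_. borel) Z UNIV"
    and int: "\<And>i. integrable M (Z i)" and int2: "\<And>i. integrable M (\<lambda>\<omega>. (Z i \<omega>)\<^sup>2)"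
    and mean: "\<And>i. expectation (Z i) = 0"
  shows "integrable M (\<lambda>\<omega>. (\<Sum>i<n. Z i \<omega>)\<^sup>2)"
    and "expectation (\<lambda>\<omega>. (\<Sum>i<n. Z i \<omega>)\<^sup>2) = (\<Sum>i<n. expectation (\<lambda>\<omega>. (Z i \<omega>)\<^sup>2))"
proof -
  have "integrable M (\<lambda>\<omega>. (\<Sum>i<n. Z i \<omega>)\<^sup>2) \<and>
    expectation (\<lambda>\<omega>. (\<Sum>i<n. Z i \<omega>)\<^sup>2) = (\<Sum>i<n. expectation (\<lambda>\<omega>. (Z i \<omega>)\<^sup>2))"
  proof (induction n)
    case (Suc n)
    let ?S = "\<lambda>\<omega>. \<Sum>i<n. Z i \<omega>"
    have indep': "indep_var borel (Z n) borel ?S"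
      using indep by (intro indep_vars_sum) (auto intro: indep_vars_subset)
    have int_S: "integrable M ?S"
      using int by simp
    have int_prod: "integrable M (\<lambda>\<omega>. Z n \<omega> * ?S \<omega>)"
      using indep' int int_S by (rule indep_var_integrable)
    have exp_prod: "expectation (\<lambda>\<omega>. Z n \<omega> * ?S \<omega>) = 0"
      using indep_var_lebesgue_integral[OF indep' int int_S] mean by simp
    have expand: "(\<Sum>i<Suc n. Z i \<omega>)\<^sup>2 = (?S \<omega>)\<^sup>2 + 2 * (Z n \<omega> * ?S \<omega>) + (Z n \<omega>)\<^sup>2" for \<omega>
      by (simp add: power2_eq_square algebra_simps)
    show ?case
      unfolding expand using Suc int_prod exp_prod int2 by simp
  qed simp
  then show "integrable M (\<lambda>\<omega>. (\<Sum>i<n. Z i \<omega>)\<^sup>2)"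
    and "expectation (\<lambda>\<omega>. (\<Sum>i<n. Z i \<omega>)\<^sup>2) = (\<Sum>i<n. expectation (\<lambda>\<omega>. (Z i \<omega>)\<^sup>2))"
    by blast+
qed

lemma (in prob_space) sample_variance_unbiased:
  fixes Y :: "nat \<Rightarrow> 'a \<Rightarrow> real"
  assumes indep: "indep_vars (\<lambda>_. borel) Y UNIV"
    and int: "\<And>i. integrable M (Y i)" and int2: "\<And>i. integrable M (\<lambda>\<omega>. (Y i \<omega> - c)\<^sup>2)"
    and mean: "\<And>i. expectation (Y i) = c"
    and var: "\<And>i. expectation (\<lambda>\<omega>. (Y i \<omega> - c)\<^sup>2) = v"
    and K: "K \<ge> 2"
  shows "integrable M (\<lambda>\<omega>. sample_variance (\<lambda>i. Y i \<omega>) K)"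
    and "expectation (\<lambda>\<omega>. sample_variance (\<lambda>i. Y i \<omega>) K) = v"
proof -
  have indep': "indep_vars (\<lambda>_. borel) (\<lambda>i \<omega>. Y i \<omega> - c) UNIV"
    using indep by (rule indep_vars_compose2) auto
  have int': "integrable M (\<lambda>\<omega>. Y i \<omega> - c)" and mean': "expectation (\<lambda>\<omega>. Y i \<omega> - c) = 0" for i
    using int mean by (auto simp: prob_space)
  note sq = centred_indep_sum_square[OF indep' int' int2 mean', of K]
  have eq: "sample_variance (\<lambda>i. Y i \<omega>) K =
      1 / (real K - 1) * ((\<Sum>j<K. (Y j \<omega> - c)\<^sup>2) - (\<Sum>j<K. Y j \<omega> - c)\<^sup>2 / real K)" for \<omega>
    using K unfolding sample_variance_def by (subst sum_squared_deviations[of K _ c]) auto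
  show "integrable M (\<lambda>\<omega>. sample_variance (\<lambda>i. Y i \<omega>) K)"
    unfolding eq using sq(1) int2 by simp
  have "expectation (\<lambda>\<omega>. sample_variance (\<lambda>i. Y i \<omega>) K) =
      1 / (real K - 1) * (real K * v - real K * v / real K)"
    unfolding eq using sq int2 var by simp
  also have "\<dots> = v"
    using K by (simp add: field_simps)
  finally show "expectation (\<lambda>\<omega>. sample_variance (\<lambda>i. Y i \<omega>) K) = v" .
qed

lemma sample_variance_tendsto:
  fixes y :: "nat \<Rightarrow> real"
  assumes sq: "(\<lambda>n. (\<Sum>i<n. (y i - c)\<^sup>2) / real n) \<longlonglongrightarrow> v"
    and mean: "(\<lambda>n. (\<Sum>i<n. y i - c) / real n) \<longlonglongrightarrow> 0"
  shows "sample_variance y \<longlonglongrightarrow> v"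
proof -
  have ratio: "(\<lambda>n. real n / (real n - 1)) \<longlonglongrightarrow> 1"
    by real_asymp
  have "(\<lambda>n. real n / (real n - 1) *
      ((\<Sum>i<n. (y i - c)\<^sup>2) / real n - ((\<Sum>i<n. y i - c) / real n)\<^sup>2)) \<longlonglongrightarrow> 1 * (v - 0\<^sup>2)"
    by (intro tendsto_intros ratio sq mean)
  then have lim: "(\<lambda>n. real n / (real n - 1) *
      ((\<Sum>i<n. (y i - c)\<^sup>2) / real n - ((\<Sum>i<n. y i - c) / real n)\<^sup>2)) \<longlonglongrightarrow> v"
    by simp
  show ?thesis
  proof (rule Lim_transform_eventually[OF lim])
    show "\<forall>\<^sub>F n in sequentially. real n / (real n - 1) *
      ((\<Sum>i<n. (y i - c)\<^sup>2) / real n - ((\<Sum>i<n. y i - c) / real n)\<^sup>2) = sample_variance y n"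
      using eventually_ge_at_top[of 2]
    proof eventually_elim
      case (elim n)
      have "a / real n - (b / real n)\<^sup>2 = (a - b\<^sup>2 / real n) / real n" for a b :: real
        by (simp add: power2_eq_square diff_divide_distrib)
      with elim show ?case
        unfolding sample_variance_def by (subst sum_squared_deviations[of n y c]) auto
    qed
  qed
qed

lemma (in prob_space) sample_variance_consistent:
  fixes Y :: "nat \<Rightarrow> 'a \<Rightarrow> real"
  assumes indep: "indep_vars (\<lambda>_. borel) Y UNIV"
    and ident: "\<And>i. distr M borel (Y i) = distr M borel (Y 0)"
    and int: "integrable M (Y 0)" and int2: "integrable M (\<lambda>\<omega>. (Y 0 \<omega> - expectation (Y 0))\<^sup>2)"
  shows "AE \<omega> in M. sample_variance (\<lambda>i. Y i \<omega>) \<longlonglongrightarrow> variance (Y 0)"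
proof -
  let ?c = "expectation (Y 0)"
  have rv: "random_variable borel (Y i)" for i
    using indep by (auto simp: indep_vars_def2)
  have law: "AE \<omega> in M. (\<lambda>n. (\<Sum>i<n. f (Y i \<omega>)) / real n) \<longlonglongrightarrow> expectation (\<lambda>\<omega>. f (Y 0 \<omega>))"
    if f: "f \<in> borel_measurable borel" and "integrable M (\<lambda>\<omega>. f (Y 0 \<omega>))" for f :: "real \<Rightarrow> real"
  proof (rule strong_law_of_large_numbers)
    show "indep_vars (\<lambda>_. borel) (\<lambda>i \<omega>. f (Y i \<omega>)) UNIV"
      using indep f by (rule indep_vars_compose2)
    show "distr M borel (\<lambda>\<omega>. f (Y i \<omega>)) = distr M borel (\<lambda>\<omega>. f (Y 0 \<omega>))" for i
      using distr_distr[OF f rv[of i]] distr_distr[OF f rv[of 0]] ident[of i]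
      by (simp add: comp_def)
  qed fact
  have "AE \<omega> in M. (\<lambda>n. (\<Sum>i<n. (Y i \<omega> - ?c)\<^sup>2) / real n) \<longlonglongrightarrow> variance (Y 0)"
    using int2 by (intro law[of "\<lambda>y. (y - ?c)\<^sup>2"]) auto
  moreover have "AE \<omega> in M. (\<lambda>n. (\<Sum>i<n. Y i \<omega> - ?c) / real n) \<longlonglongrightarrow> expectation (\<lambda>\<omega>. Y 0 \<omega> - ?c)"
    using int by (intro law[of "\<lambda>y. y - ?c"]) auto
  moreover have "expectation (\<lambda>\<omega>. Y 0 \<omega> - ?c) = 0"
    using int by (simp add: prob_space)
  ultimately show ?thesis
    by (auto intro: sample_variance_tendsto elim!: eventually_elim2)
qed

section \<open>The logarithmic variance estimator\<close>

theorem theorem4p2: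
  fixes M :: "'a measure" and X :: "nat \<Rightarrow> 'a \<Rightarrow> real" and ml \<sigma>2 :: real
  assumes "prob_space M"
    and "iid_from_one M X"
    and "\<And>j. j \<ge> 1 \<Longrightarrow> finite_log_variance M (X j)"
    and "\<And>j. j \<ge> 1 \<Longrightarrow> log_mean M (X j) = ml"
    and "\<And>j. j \<ge> 1 \<Longrightarrow> log_variance M (X j) = \<sigma>2"
  shows "(\<forall>K\<ge>2. unbiased_estimator M (log_variance_est X K) \<sigma>2) \<and>
         (AE \<omega> in M. (\<lambda>K. log_variance_est X K \<omega>) \<longlonglongrightarrow> \<sigma>2)"
proof -
  interpret prob_space M
    by fact
  define Y where "Y = (\<lambda>i \<omega>. ln (X (Suc i) \<omega>))"
  have rv [measurable]: "random_variable borel (X (Suc i))"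
    and pos: "\<omega> \<in> space M \<Longrightarrow> X (Suc i) \<omega> > 0"
    and sq: "integrable M (\<lambda>\<omega>. (Y i \<omega>)\<^sup>2)" for i \<omega>
    using assms(3)[of "Suc i"] by (auto simp: finite_log_variance_def Y_def)
  have rvY: "random_variable borel (Y i)" for i
    unfolding Y_def by measurable
  have int: "integrable M (Y i)" for i
    using rvY sq by (rule square_integrable_imp_integrable)
  have mean: "expectation (Y i) = ln ml" for i
    using assms(4)[of "Suc i", symmetric] by (simp add: log_mean_def Y_def)
  have var: "expectation (\<lambda>\<omega>. (Y i \<omega> - ln ml)\<^sup>2) = \<sigma>2" for i
    using assms(4)[of "Suc i"] assms(5)[of "Suc i"] by (simp add: log_variance_def Y_def)
  have int2: "integrable M (\<lambda>\<omega>. (Y i \<omega> - ln ml)\<^sup>2)" for i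
    using sq[of i] int[of i] by (simp add: power2_diff)
  have "indep_vars (\<lambda>_. borel) X (Suc ` UNIV)"
    using assms(2) by (auto simp: iid_from_one_def intro: indep_vars_subset)
  then have "indep_vars (\<lambda>_. borel) (\<lambda>i. X (Suc i)) UNIV"
    by (rule indep_vars_reindex) simp
  then have indep: "indep_vars (\<lambda>_. borel) Y UNIV"
    unfolding Y_def by (rule indep_vars_compose2) auto
  have ident: "distr M borel (Y i) = distr M borel (Y 0)" for i
  proof -
    have "distr M borel (X (Suc i)) = distr M borel (X (Suc 0))"
      using assms(2) unfolding iid_from_one_def by (metis One_nat_def Suc_le_mono zero_le)
    then show ?thesis
      using distr_distr[of ln borel borel "X (Suc i)" M] distr_distr[of ln borel borel "X (Suc 0)" M]
      by (simp add: comp_def Y_def)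
  qed
  have est: "log_variance_est X K \<omega> = sample_variance (\<lambda>i. Y i \<omega>) K" if "\<omega> \<in> space M" for K \<omega>
    unfolding Y_def
  proof (rule log_variance_est_eq_sample_variance)
    show "X j \<omega> > 0" if "j \<ge> 1" for j
      using pos[OF \<open>\<omega> \<in> space M\<close>, of "j - 1"] that by simp
  qed
  have "unbiased_estimator M (log_variance_est X K) \<sigma>2" if "K \<ge> 2" for K
    unfolding unbiased_estimator_def
    using sample_variance_unbiased[OF indep int int2 mean var that] est
    by (simp cong: Bochner_Integration.integrable_cong Bochner_Integration.integral_cong)
  moreover have "AE \<omega> in M. sample_variance (\<lambda>i. Y i \<omega>) \<longlonglongrightarrow> \<sigma>2"
    using sample_variance_consistent[OF indep ident int] int2 mean var by simp
  then have "AE \<omega> in M. (\<lambda>K. log_variance_est X K \<omega>) \<longlonglongrightarrow> \<sigma>2"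
    using AE_space by eventually_elim (simp add: est)
  ultimately show ?thesis
    by blast
qed

end
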